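(* Let $(p_k)_{k\ge 0}$ be a probability distribution on $\mathbb N=\{0,1,2,\dots\}$ with $p_0>0$, $p_0+p_1<1$, $\sum_{k\ge0}k\,p_k<1$, and $R(v):=\sum_{k\ge2}p_kv^k<\infty$ for all $v\geq 0$. Let $x\in\{1,2\}$, and consider the interacting tree measures $\mathbb P_n^x$ defined in the context at the critical value $b=e^\beta=b_c$. Let $N_n$ be the number of external nodes. Then there is a constant $C>1$ such that for all $n\ge1$, $$C^{-1}<n^2\,\mathbb E_n^x N_n<C.$$
   Context: Trees. $\mathcal T_n$ is the set of planar rooted trees in which the root has distance $0$, and the nodes $i\in\omega$ are those at distance $|i|\le n$ from the root; each node $i\in\omega$ has a number of offspring $X_i=X_i(\omega)\in\mathbb N$. The offspring of nodes at distance exactly $n$ (located at distance $n+1$) are called external nodes; they carry no information other than their number and are not counted among the nodes $i\in\omega$. Thus $N_n(\omega)=\sum_{i\in\omega,\,|i|=n}X_i(\omega)$. The root is denoted $0$, and $a(i)$ is the parent of node $i$. For the root, $X_{a(0)}:=x$ is a prescribed boundary condition. Free measure: $\mathbb P^{GW}(\omega)=\prod_{i\in\omega}p_{X_i(\omega)}$ for $\omega\in\mathcal T_n$. Interaction: $\varphi(X,Y)=-1_{X\ge2}1_{Y\ge2}$ and $H_n^x(\omega)=\sum_{i\in\omega}\varphi(X_{a(i)},X_i)$ (the root contributes $\varphi(x,X_0)$). Interacting measure: with $b=e^\beta$, $\Xi_n^x=\sum_{\omega\in\mathcal T_n}\mathbb P^{GW}(\omega)e^{-\beta H_n^x(\omega)}$,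 $\mathbb P_n^x(\omega)=(\Xi_n^x)^{-1}\mathbb P^{GW}(\omega)e^{-\beta H_n^x(\omega)}$, and $\mathbb E_n^x$ is the expectation under $\mathbb P_n^x$. Critical value: $(b_c,v_c)$ is the solution $(b,v)$ with $v\ge1$ of the system $$v=\frac{p_0}{1-p_1}+\frac{(1-p_1)b+p_1}{1-p_1}R(v),\qquad 1=\frac{(1-p_1)b+p_1}{1-p_1}R'(v).$$ *)

theory Defs
  imports "HOL-Probability.Probability"
begin

datatype ptree = Node (children: "ptree list")

text \<open>A vertex is addressed by the path of child positions leading to it from the root.
  Thus the root is \<open>[]\<close>, the distance to the root is the length of the address, and the parent
  of \<open>i \<noteq> []\<close> is \<open>butlast i\<close>.\<close>

primrec is_vertex :: "nat list \<Rightarrow> ptree \<Rightarrow> bool" where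
  "is_vertex [] t \<longleftrightarrow> True"
| "is_vertex (k # i) t \<longleftrightarrow> k < length (children t) \<and> is_vertex i (children t ! k)"

text \<open>Only meaningful at addresses satisfying \<^const>\<open>is_vertex\<close>.\<close>

primrec subtree_at :: "nat list \<Rightarrow> ptree \<Rightarrow> ptree" where
  "subtree_at [] t = t"
| "subtree_at (k # i) t = subtree_at i (children t ! k)"

definition offspring :: "ptree \<Rightarrow> nat list \<Rightarrow> nat" where
  "offspring t i = length (children (subtree_at i t))"

text \<open>External nodes are represented by the vertices at distance \<open>n + 1\<close>. In \<open>trees n\<close> they have
  no children, so they carry no information beyond their number, and they are excluded from
  \<open>nodes n t\<close>.\<close>

definition trees :: "nat \<Rightarrow> ptree set" where
  "trees n = {t. \<forall>i. is_vertex i t \<longrightarrow> length i \<le> n + 1}"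

definition nodes :: "nat \<Rightarrow> ptree \<Rightarrow> nat list set" where
  "nodes n t = {i. is_vertex i t \<and> length i \<le> n}"

definition num_external :: "nat \<Rightarrow> ptree \<Rightarrow> nat" where
  "num_external n t = (\<Sum>i \<in> {i \<in> nodes n t. length i = n}. offspring t i)"

definition parent_offspring :: "nat \<Rightarrow> ptree \<Rightarrow> nat list \<Rightarrow> nat" where
  "parent_offspring x t i = (if i = [] then x else offspring t (butlast i))"

definition gw_weight :: "nat pmf \<Rightarrow> nat \<Rightarrow> ptree \<Rightarrow> real" where
  "gw_weight p n t = (\<Prod>i \<in> nodes n t. pmf p (offspring t i))"

definition interaction :: "nat \<Rightarrow> nat \<Rightarrow> real" where
  "interaction X Y = - (of_bool (X \<ge> 2) * of_bool (Y \<ge> 2))"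

definition energy :: "nat \<Rightarrow> nat \<Rightarrow> ptree \<Rightarrow> real" where
  "energy x n t = (\<Sum>i \<in> nodes n t. interaction (parent_offspring x t i) (offspring t i))"

text \<open>The sums over \<open>trees n\<close> are infinite, with value \<open>0\<close> when they do not converge; a positive
  expectation therefore forces both the partition function and the expectation to converge.\<close>

definition partition_function :: "nat pmf \<Rightarrow> real \<Rightarrow> nat \<Rightarrow> nat \<Rightarrow> real" where
  "partition_function p \<beta> x n =
     (\<Sum>\<^sub>\<infinity>t \<in> trees n. gw_weight p n t * exp (- \<beta> * energy x n t))"

definition gibbs_prob :: "nat pmf \<Rightarrow> real \<Rightarrow> nat \<Rightarrow> nat \<Rightarrow> ptree \<Rightarrow> real" where
  "gibbs_prob p \<beta> x n t =
     gw_weight p n t * exp (- \<beta> * energy x n t) / partition_function p \<beta> x n"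

definition gibbs_expectation ::
    "nat pmf \<Rightarrow> real \<Rightarrow> nat \<Rightarrow> nat \<Rightarrow> (ptree \<Rightarrow> real) \<Rightarrow> real" where
  "gibbs_expectation p \<beta> x n f = (\<Sum>\<^sub>\<infinity>t \<in> trees n. gibbs_prob p \<beta> x n t * f t)"

definition R :: "nat pmf \<Rightarrow> real \<Rightarrow> real" where
  "R p v = (\<Sum>k. pmf p (k + 2) * v ^ (k + 2))"

definition critical_system :: "nat pmf \<Rightarrow> real \<Rightarrow> real \<Rightarrow> bool" where
  "critical_system p b v \<longleftrightarrow>
     v = pmf p 0 / (1 - pmf p 1) + ((1 - pmf p 1) * b + pmf p 1) / (1 - pmf p 1) * R p v \<and>
     1 = ((1 - pmf p 1) * b + pmf p 1) / (1 - pmf p 1) * deriv (R p) v"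

text \<open>If \<open>p\<close> is subcritical with \<open>p\<^sub>0 > 0\<close>, \<open>p\<^sub>0 + p\<^sub>1 < 1\<close> and \<open>R\<close> is entire, there is exactly one
  solution with \<open>v \<ge> 1\<close>, and it has \<open>b > 1\<close>. Otherwise the description may be unspecified.\<close>

definition critical_pair :: "nat pmf \<Rightarrow> real \<times> real" where
  "critical_pair p = (THE bv. snd bv \<ge> 1 \<and> critical_system p (fst bv) (snd bv))"

definition b_crit :: "nat pmf \<Rightarrow> real" where
  "b_crit p = fst (critical_pair p)"

end

theory Submission
  imports Defs
begin

text \<open>Let \<open>u\<^sub>k\<close> and \<open>w\<^sub>k\<close> be the partition functions with \<open>k\<close> levels and boundary condition \<open>1\<close>
  and \<open>2\<close>. Decomposing at the root gives \<open>u\<^sub>0 = w\<^sub>0 = 1\<close>,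
  \<open>u\<^bsub>k+1\<^esub> = p\<^sub>0 + p\<^sub>1 u\<^sub>k + R(w\<^sub>k)\<close> and \<open>w\<^bsub>k+1\<^esub> = p\<^sub>0 + p\<^sub>1 u\<^sub>k + b R(w\<^sub>k)\<close>. Weighting every external
  node by \<open>s\<close> replaces the initial value \<open>1\<close> by \<open>s\<close>, so the unnormalised expectation of \<open>N\<^sub>n\<close> is
  the derivative at \<open>s = 1\<close>, which follows the linearised recursion.

  At \<open>b = b\<^sub>c\<close> the fixed point \<open>(u\<^sub>c, v)\<close> is a double root: along the left eigenvector for the
  eigenvalue \<open>1\<close> the distance \<open>S\<^sub>k\<close> to the fixed point satisfies \<open>S\<^sub>k - S\<^bsub>k+1\<^esub> \<asymp> S\<^sub>k\<^sup>2\<close>, so that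
  \<open>S\<^sub>k \<asymp> 1/k\<close> and the increments of \<open>(u, w)\<close> are of order \<open>1/k\<^sup>2\<close>. By convexity of \<open>R\<close> the
  increments dominate, and with a shift of the index are dominated by, solutions of the linearised
  recursion; hence the derivative has the same order.\<close>

subsection \<open>Recursive form of the Gibbs weights\<close>

lemma nodes_0: "nodes 0 t = {[]}"
  by (auto simp: nodes_def)

lemma nodes_Suc:
  "nodes (Suc n) t = insert [] (\<Union>k<length (children t). (#) k ` nodes n (children t ! k))"
proof -
  have "i \<in> nodes (Suc n) t \<longleftrightarrow>
      i \<in> insert [] (\<Union>k<length (children t). (#) k ` nodes n (children t ! k))" for i
    by (cases i) (auto simp: nodes_def)
  then show ?thesis by blast
qed

lemma finite_nodes [simp]: "finite (nodes n t)"
  by (induction n arbitrary: t) (auto simp: nodes_0 nodes_Suc)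

lemma prod_nodes_Suc:
  fixes f :: "nat list \<Rightarrow> 'a::comm_monoid_mult"
  shows "prod f (nodes (Suc n) t) =
    f [] * (\<Prod>k<length (children t). \<Prod>i\<in>nodes n (children t ! k). f (k # i))"
  unfolding nodes_Suc
  by (subst prod.insert, (force+)[2], subst prod.UNION_disjoint)
     (auto simp: prod.reindex)

lemma sum_nodes_Suc:
  fixes f :: "nat list \<Rightarrow> 'a::comm_monoid_add"
  shows "sum f (nodes (Suc n) t) =
    f [] + (\<Sum>k<length (children t). \<Sum>i\<in>nodes n (children t ! k). f (k # i))"
  unfolding nodes_Suc
  by (subst sum.insert, (force+)[2], subst sum.UNION_disjoint)
     (auto simp: sum.reindex)

lemma offspring_Nil: "offspring t [] = length (children t)"
  by (simp add: offspring_def)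

lemma offspring_Cons: "offspring t (k # i) = offspring (children t ! k) i"
  by (simp add: offspring_def)

lemma parent_offspring_Cons:
  "parent_offspring x t (k # i) = parent_offspring (length (children t)) (children t ! k) i"
  by (auto simp: parent_offspring_def offspring_Nil offspring_Cons)

text \<open>The level argument counts the generations that carry weight, so \<open>trees n\<close>
  corresponds to \<open>Suc n\<close>; at level 0 an external node contributes the factor 1.\<close>

fun boltzmann :: "nat pmf \<Rightarrow> real \<Rightarrow> nat \<Rightarrow> nat \<Rightarrow> ptree \<Rightarrow> real" where
  "boltzmann p \<beta> 0 x t = 1"
| "boltzmann p \<beta> (Suc k) x t =
     pmf p (length (children t)) * exp (- \<beta> * interaction x (length (children t))) *
     prod_list (map (boltzmann p \<beta> k (length (children t))) (children t))"

fun level_size :: "nat \<Rightarrow> ptree \<Rightarrow> nat" where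
  "level_size 0 t = 1"
| "level_size (Suc k) t = sum_list (map (level_size k) (children t))"

lemma boltzmann_nonneg: "boltzmann p \<beta> k x t \<ge> 0"
proof (induction k arbitrary: x t)
  case (Suc k)
  then have "prod_list (map (boltzmann p \<beta> k m) ts) \<ge> 0" for m ts
    by (intro prod_list_nonneg) auto
  then show ?case by simp
qed simp

lemma prod_list_map_nth: "prod_list (map f xs) = (\<Prod>k<length xs. f (xs ! k))"
  by (simp add: prod.list_conv_set_nth atLeast0LessThan)

lemma sum_list_map_nth: "sum_list (map f xs) = (\<Sum>k<length xs. f (xs ! k))"
  by (simp add: sum.list_conv_set_nth atLeast0LessThan)

text \<open>Both factors are products over nodes of a local weight that sees only a node and its
  parent. Splitting off the root leaves one factor per child, whose boundary condition is the
  offspring number of the root.\<close>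

lemma gw_weight_boltzmann:
  "gw_weight p n t * exp (- \<beta> * energy x n t) = boltzmann p \<beta> (Suc n) x t"
proof -
  define w where
    "w x t i = pmf p (offspring t i) * exp (- \<beta> * interaction (parent_offspring x t i) (offspring t i))"
    for x t i
  have "gw_weight p n t * exp (- \<beta> * energy x n t) = prod (w x t) (nodes n t)" for n t x
    by (simp add: gw_weight_def energy_def w_def exp_sum sum_distrib_left sum_negf prod.distrib
             flip: exp_sum)
  moreover have "prod (w x t) (nodes n t) = boltzmann p \<beta> (Suc n) x t"
  proof (induction n arbitrary: x t)
    case 0
    show ?case by (simp add: nodes_0 w_def offspring_Nil parent_offspring_def prod_list_map_nth)
  next
    case (Suc n)
    have "w x t (k # i) = w (length (children t)) (children t ! k) i" for k i
      by (simp add: w_def offspring_Cons parent_offspring_Cons)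
    then have "prod (w x t) (nodes (Suc n) t) =
        w x t [] * (\<Prod>k<length (children t). boltzmann p \<beta> (Suc n) (length (children t)) (children t ! k))"
      using Suc by (simp add: prod_nodes_Suc)
    then show ?case
      by (subst boltzmann.simps, simp only: prod_list_map_nth)
         (simp add: w_def offspring_Nil parent_offspring_def)
  qed
  ultimately show ?thesis by simp
qed

lemma num_external_level_size: "num_external n t = level_size (Suc n) t"
proof -
  have *: "num_external n t = (\<Sum>i\<in>nodes n t. if length i = n then offspring t i else 0)" for n t
    unfolding num_external_def by (subst sum.inter_filter) auto
  show ?thesis
  proof (induction n arbitrary: t)
    case 0
    then show ?case by (simp add: * nodes_0 offspring_Nil sum_list_map_nth)
  next
    case (Suc n)
    have "num_external (Suc n) t = (\<Sum>k<length (children t). num_external n (children t ! k))"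
      by (simp add: * sum_nodes_Suc offspring_Cons cong: if_cong)
    then show ?case
      using Suc by (subst level_size.simps, simp only: sum_list_map_nth)
  qed
qed

section \<open>Summation over trees of bounded height\<close>

definition trees_within :: "nat \<Rightarrow> ptree set" where
  "trees_within k = {t. \<forall>i. is_vertex i t \<longrightarrow> length i \<le> k}"

lemma trees_eq_trees_within: "trees n = trees_within (Suc n)"
  by (simp add: trees_def trees_within_def)

lemma trees_within_0: "trees_within 0 = {Node []}"
proof -
  have "t \<in> trees_within 0 \<longleftrightarrow> t = Node []" for t
  proof (cases t)
    case (Node ts)
    have "is_vertex [0] (Node ts) \<longleftrightarrow> ts \<noteq> []" by simp
    moreover have "is_vertex i (Node []) \<Longrightarrow> i = []" for i by (cases i) auto
    ultimately show ?thesis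
      unfolding trees_within_def Node
      by (force simp del: is_vertex.simps)
  qed
  then show ?thesis by blast
qed

lemma trees_within_Suc: "trees_within (Suc k) = Node ` lists (trees_within k)"
proof -
  have *: "Node ts \<in> trees_within (Suc k) \<longleftrightarrow> ts \<in> lists (trees_within k)" for ts
  proof -
    have "Node ts \<in> trees_within (Suc k) \<longleftrightarrow>
        (\<forall>j i. j < length ts \<and> is_vertex i (ts ! j) \<longrightarrow> length i \<le> k)"
      unfolding trees_within_def
      by (auto simp: all_conj_distrib) (metis Suc_le_mono is_vertex.simps(2) length_Cons ptree.sel,
          metis Suc_le_mono is_vertex.simps length_Cons list.exhaust list.size(3) ptree.sel zero_le)
    also have "\<dots> \<longleftrightarrow> ts \<in> lists (trees_within k)"
      by (auto simp: in_lists_conv_set all_set_conv_all_nth trees_within_def)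
    finally show ?thesis .
  qed
  show ?thesis
  proof (rule set_eqI)
    show "t \<in> trees_within (Suc k) \<longleftrightarrow> t \<in> Node ` lists (trees_within k)" for t
      by (cases t) (simp add: * image_iff del: in_lists_conv_set lists_UNIV)
  qed
qed

lemma has_sum_Times_nonneg:
  fixes f :: "'a \<Rightarrow> real" and F :: "'b \<Rightarrow> real"
  assumes f: "(f has_sum S) A" and F: "(F has_sum T) L"
    and nonneg: "\<And>t. t \<in> A \<Longrightarrow> f t \<ge> 0" "\<And>ts. ts \<in> L \<Longrightarrow> F ts \<ge> 0"
  shows "((\<lambda>(t, ts). f t * F ts) has_sum S * T) (A \<times> L)"
proof (rule has_sum_SigmaI)
  show "((\<lambda>y. case (t, y) of (t, ts) \<Rightarrow> f t * F ts) has_sum f t * T) L" if "t \<in> A" for t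
    using has_sum_cmult_right[OF F] by simp
  then show "(\<lambda>(t, ts). f t * F ts) summable_on A \<times> L"
    by (rule summable_on_SigmaI)
       (use f nonneg in \<open>auto intro!: has_sum_imp_summable has_sum_cmult_left\<close>)
  show "((\<lambda>t. f t * T) has_sum S * T) A"
    by (intro has_sum_cmult_left f)
qed

text \<open>The second sum is a product rule: each of the \<open>m\<close> entries in turn carries
  the factor \<open>g\<close>, while the others contribute \<open>S\<close>. This replaces
  differentiation with respect to the initial value.\<close>

lemma has_sum_lists_of_length:
  fixes f g :: "'a \<Rightarrow> real"
  assumes f: "(f has_sum S) A" and g: "((\<lambda>t. f t * g t) has_sum T) A"
    and nonneg: "\<And>t. t \<in> A \<Longrightarrow> f t \<ge> 0" "\<And>t. t \<in> A \<Longrightarrow> g t \<ge> 0"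
  defines "L m \<equiv> {ts \<in> lists A. length ts = m}"
  shows "((\<lambda>ts. prod_list (map f ts)) has_sum S ^ m) (L m) \<and>
    ((\<lambda>ts. prod_list (map f ts) * sum_list (map g ts)) has_sum (real m * S ^ (m - 1) * T)) (L m)"
proof (induction m)
  case 0
  have "L 0 = {[]}" by (auto simp: L_def)
  then show ?case by (auto simp: has_sum_finite_iff)
next
  case (Suc m)
  have bij: "bij_betw (\<lambda>(t, ts). t # ts) (A \<times> L m) (L (Suc m))"
    by (rule bij_betwI[where g = "\<lambda>ts. (hd ts, tl ts)"])
       (auto simp: L_def length_Suc_conv)
  have nn: "prod_list (map f ts) \<ge> 0" "sum_list (map g ts) \<ge> 0" if "ts \<in> L m" for ts
    using that nonneg by (auto simp: L_def intro!: prod_list_nonneg sum_list_nonneg)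
  have 1: "((\<lambda>(t, ts). f t * prod_list (map f ts)) has_sum S * S ^ m) (A \<times> L m)"
    using Suc nn nonneg f by (intro has_sum_Times_nonneg) auto
  have 2: "((\<lambda>(t, ts). (f t * g t) * prod_list (map f ts)) has_sum T * S ^ m) (A \<times> L m)"
    using Suc nn nonneg g by (intro has_sum_Times_nonneg) auto
  have 3: "((\<lambda>(t, ts). f t * (prod_list (map f ts) * sum_list (map g ts)))
      has_sum S * (real m * S ^ (m - 1) * T)) (A \<times> L m)"
    using Suc nn nonneg f by (intro has_sum_Times_nonneg) auto
  have "((\<lambda>(t, ts). prod_list (map f (t # ts)) * sum_list (map g (t # ts)))
      has_sum (T * S ^ m + S * (real m * S ^ (m - 1) * T))) (A \<times> L m)"
    using has_sum_add[OF 2 3] by (simp add: case_prod_unfold algebra_simps)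
  \<comment> \<open>The case \<open>m = 0\<close> is separate because \<open>m - 1\<close> truncates
    there; the factor \<open>real m\<close> removes the term.\<close>
  also have "T * S ^ m + S * (real m * S ^ (m - 1) * T) = real (Suc m) * S ^ (Suc m - 1) * T"
    by (cases m) (auto simp: algebra_simps)
  finally show ?case
    using 1 by (auto simp: has_sum_reindex_bij_betw[OF bij, symmetric] case_prod_unfold)
qed

lemma has_sum_lists:
  fixes F :: "'a list \<Rightarrow> real"
  assumes "\<And>m. (F has_sum c m) {ts \<in> lists A. length ts = m}" "c sums S"
    and nonneg: "\<And>ts. ts \<in> lists A \<Longrightarrow> F ts \<ge> 0"
  shows "(F has_sum S) (lists A)"
proof -
  define L where "L m = {ts \<in> lists A. length ts = m}" for m
  have c: "c m \<ge> 0" for m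
    using assms(1)[of m] by (rule has_sum_nonneg) (use nonneg in auto)
  have c_sum: "(c has_sum S) UNIV"
    using assms(2) c by (intro sums_nonneg_imp_has_sum) auto
  have "((\<lambda>(m, ts). F ts) has_sum S) (Sigma UNIV L)"
  proof (rule has_sum_SigmaI[OF _ c_sum])
    show "((\<lambda>y. case (m, y) of (m, ts) \<Rightarrow> F ts) has_sum c m) (L m)" for m
      using assms(1)[of m] by (simp add: L_def)
    then show "(\<lambda>(m, ts). F ts) summable_on Sigma UNIV L"
      using has_sum_imp_summable[OF c_sum] nonneg
      by (intro summable_on_SigmaI) (auto simp: L_def)
  qed
  moreover have "bij_betw (\<lambda>(m, ts). ts) (Sigma UNIV L) (lists A)"
    by (rule bij_betwI[where g = "\<lambda>ts. (length ts, ts)"]) (auto simp: L_def)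
  ultimately show ?thesis
    by (simp add: has_sum_reindex_bij_betw[symmetric] case_prod_unfold)
qed

text \<open>A tree is a root with a list of trees of one level less. The index of \<open>f\<close>
  and \<open>S\<close> is the number of siblings, because the offspring number of the root is the
  boundary condition of its children; \<open>c\<close> is the weight of the root.\<close>

lemma has_sum_trees_within_Suc:
  fixes f :: "nat \<Rightarrow> ptree \<Rightarrow> real" and g :: "ptree \<Rightarrow> real"
  assumes f: "\<And>m. (f m has_sum S m) (trees_within k)"
    and g: "\<And>m. ((\<lambda>t. f m t * g t) has_sum T m) (trees_within k)"
    and nonneg: "\<And>m t. f m t \<ge> 0" "\<And>t. g t \<ge> 0" "\<And>m. c m \<ge> 0"
    and S': "(\<lambda>m. c m * S m ^ m) sums S'"
    and T': "(\<lambda>m. c m * (real m * S m ^ (m - 1) * T m)) sums T'"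
  shows "((\<lambda>t. c (length (children t)) * prod_list (map (f (length (children t))) (children t)))
      has_sum S') (trees_within (Suc k))"
    and "((\<lambda>t. c (length (children t)) * prod_list (map (f (length (children t))) (children t)) *
      sum_list (map g (children t))) has_sum T') (trees_within (Suc k))"
proof -
  have inj: "inj_on Node (lists (trees_within k))"
    by (auto intro: inj_onI)
  note * = has_sum_lists_of_length[OF f g nonneg(1,2)]
  have "((\<lambda>ts. c (length ts) * prod_list (map (f (length ts)) ts)) has_sum S') (lists (trees_within k))"
  proof (rule has_sum_lists[OF _ S'])
    fix m
    show "((\<lambda>ts. c (length ts) * prod_list (map (f (length ts)) ts)) has_sum c m * S m ^ m)
        {ts \<in> lists (trees_within k). length ts = m}"
      using has_sum_cmult_right[OF *[of m m, THEN conjunct1], of "c m"]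
      by (rule has_sum_cong[THEN iffD1, rotated]) auto
  qed (use nonneg in \<open>auto intro!: mult_nonneg_nonneg prod_list_nonneg\<close>)
  then show "((\<lambda>t. c (length (children t)) * prod_list (map (f (length (children t))) (children t)))
      has_sum S') (trees_within (Suc k))"
    by (simp add: trees_within_Suc has_sum_reindex[OF inj] o_def)
  have "((\<lambda>ts. c (length ts) * prod_list (map (f (length ts)) ts) * sum_list (map g ts)) has_sum T')
      (lists (trees_within k))"
  proof (rule has_sum_lists[OF _ T'])
    fix m
    show "((\<lambda>ts. c (length ts) * prod_list (map (f (length ts)) ts) * sum_list (map g ts))
        has_sum c m * (real m * S m ^ (m - 1) * T m)) {ts \<in> lists (trees_within k). length ts = m}"
      using has_sum_cmult_right[OF *[of m m, THEN conjunct2], of "c m"]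
      by (rule has_sum_cong[THEN iffD1, rotated]) (auto simp: mult.assoc)
  qed (use nonneg in \<open>auto intro!: mult_nonneg_nonneg prod_list_nonneg sum_list_nonneg\<close>)
  then show "((\<lambda>t. c (length (children t)) * prod_list (map (f (length (children t))) (children t)) *
      sum_list (map g (children t))) has_sum T') (trees_within (Suc k))"
    by (simp add: trees_within_Suc has_sum_reindex[OF inj] o_def)
qed

subsection \<open>Recursions at a tangential fixed point\<close>

text \<open>A decrement of order \<open>s\<^sup>2\<close> makes \<open>1 / s\<close> grow by an
  amount bounded above and below, hence linearly. The hypothesis \<open>ratio\<close> replaces
  \<open>(s k)\<^sup>2\<close> by a multiple of \<open>s k * s (Suc k)\<close> in the upper
  bound.\<close>

lemma inverse_rate:
  fixes s :: "nat \<Rightarrow> real"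
  assumes pos: "\<And>k. k \<ge> 1 \<Longrightarrow> s k > 0"
    and lower: "\<And>k. k \<ge> 1 \<Longrightarrow> c * (s k)\<^sup>2 \<le> s k - s (Suc k)"
    and upper: "\<And>k. k \<ge> 1 \<Longrightarrow> s k - s (Suc k) \<le> C * (s k)\<^sup>2"
    and ratio: "\<And>k. k \<ge> 1 \<Longrightarrow> \<theta> * s k \<le> s (Suc k)"
    and c: "c > 0" and \<theta>: "\<theta> > 0"
  obtains A B where "A > 0" "\<And>k. k \<ge> 1 \<Longrightarrow> A \<le> real k * s k" "\<And>k. k \<ge> 1 \<Longrightarrow> real k * s k \<le> B"
proof -
  have diff: "1 / s (Suc k) - 1 / s k = (s k - s (Suc k)) / (s k * s (Suc k))" if "k \<ge> 1" for k
    using pos[of k] pos[of "Suc k"] that by (simp add: field_simps)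
  have C: "C > 0"
    using lower[of 1] upper[of 1] pos[of 1] c
    by (smt (verit) mult_le_cancel_right_pos zero_less_power le_refl)
  have lower': "1 / s k + c \<le> 1 / s (Suc k)" if k: "k \<ge> 1" for k
  proof -
    have sk: "s k > 0" "s (Suc k) > 0" using pos k by auto
    have "s (Suc k) \<le> s k"
      using lower[OF k] c by (smt (verit) zero_le_power2 mult_nonneg_nonneg)
    then have "c * (s k * s (Suc k)) \<le> c * (s k)\<^sup>2"
      using sk c by (simp add: power2_eq_square)
    also have "\<dots> \<le> s k - s (Suc k)" by (rule lower[OF k])
    finally show ?thesis using diff[OF k] sk by (simp add: pos_le_divide_eq[symmetric])
  qed
  have upper': "1 / s (Suc k) \<le> 1 / s k + C / \<theta>" if k: "k \<ge> 1" for k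
  proof -
    have sk: "s k > 0" "s (Suc k) > 0" using pos k by auto
    have "s k - s (Suc k) \<le> C * (s k)\<^sup>2" by (rule upper[OF k])
    also have "\<dots> = (C / \<theta>) * (s k * (\<theta> * s k))"
      using \<theta> by (simp add: power2_eq_square)
    also have "\<dots> \<le> (C / \<theta>) * (s k * s (Suc k))"
      using sk C \<theta> ratio[OF k] by (intro mult_left_mono) auto
    finally have "(s k - s (Suc k)) / (s k * s (Suc k)) \<le> C / \<theta>"
      using sk by (subst pos_divide_le_eq) auto
    then show ?thesis using diff[OF k] by simp
  qed
  \<comment> \<open>The minimum and maximum with \<open>1 / s 1\<close> make the linear bounds hold
    at \<open>k = 1\<close>.\<close>
  define lo hi where "lo = min (1 / s 1) c" and "hi = max (1 / s 1) (C / \<theta>)"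
  have lo: "lo > 0" "lo \<le> 1 / s 1" "lo \<le> c" and hi: "1 / s 1 \<le> hi" "C / \<theta> \<le> hi"
    using pos[of 1] c by (auto simp: lo_def hi_def)
  have hi0: "hi > 0" using lo hi by linarith
  have bounds: "lo * real k \<le> 1 / s k \<and> 1 / s k \<le> hi * real k" if "k \<ge> 1" for k
    using that
  proof (induction k rule: dec_induct)
    case base
    then show ?case using lo hi by simp
  next
    case (step k)
    then show ?case
      using lower'[of k] upper'[of k] lo hi by (auto simp: algebra_simps)
  qed
  show thesis
  proof (rule that[of "1 / hi" "1 / lo"])
    fix k :: nat assume k: "k \<ge> 1"
    show "1 / hi \<le> real k * s k" "real k * s k \<le> 1 / lo"
      using bounds[OF k] pos[OF k] lo hi0 by (auto simp: field_simps)
  qed (use hi0 in simp)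
qed

text \<open>\<open>a\<close> and \<open>d\<close> are the derivatives of \<open>u\<close> and \<open>w\<close> with respect to their common initial value.\<close>

locale tangent_recursion =
  fixes R R' R'' :: "real \<Rightarrow> real" and p\<^sub>0 p\<^sub>1 b v u\<^sub>c \<mu> M :: real
    and u w a d :: "nat \<Rightarrow> real"
  assumes R_deriv: "\<And>y. y \<ge> 1 \<Longrightarrow> (R has_real_derivative R' y) (at y)"
    and R'_deriv: "\<And>y. y \<ge> 1 \<Longrightarrow> (R' has_real_derivative R'' y) (at y)"
    and R''_bounds: "\<And>y. 1 \<le> y \<Longrightarrow> y \<le> v \<Longrightarrow> \<mu> \<le> R'' y \<and> R'' y \<le> M"
    and pos: "\<mu> > 0" "R 1 > 0" "R' 1 > 0"
    and p\<^sub>1: "0 \<le> p\<^sub>1" "p\<^sub>1 < 1" and b: "b > 1" and v: "v > 1" and u\<^sub>c: "u\<^sub>c \<ge> 1"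
    and total: "p\<^sub>0 + p\<^sub>1 + R 1 = 1"
    and fixed: "u\<^sub>c = p\<^sub>0 + p\<^sub>1 * u\<^sub>c + R v" "v = p\<^sub>0 + p\<^sub>1 * u\<^sub>c + b * R v"
    and critical: "((1 - p\<^sub>1) * b + p\<^sub>1) * R' v = 1 - p\<^sub>1"
    and init: "u 0 = 1" "w 0 = 1" "a 0 = 1" "d 0 = 1"
    and u_Suc: "\<And>k. u (Suc k) = p\<^sub>0 + p\<^sub>1 * u k + R (w k)"
    and w_Suc: "\<And>k. w (Suc k) = p\<^sub>0 + p\<^sub>1 * u k + b * R (w k)"
    and a_Suc: "\<And>k. a (Suc k) = p\<^sub>1 * a k + R' (w k) * d k"
    and d_Suc: "\<And>k. d (Suc k) = p\<^sub>1 * a k + b * R' (w k) * d k"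
begin

section \<open>Convexity estimates and distance to the fixed point\<close>

lemma R'_increment:
  assumes "1 \<le> x" "x \<le> y" "y \<le> v"
  shows "\<mu> * (y - x) \<le> R' y - R' x \<and> R' y - R' x \<le> M * (y - x)"
proof (cases "x = y")
  case False
  then obtain z where z: "x < z" "z < y" "R' y - R' x = (y - x) * R'' z"
    using MVT2[of x y R' R''] R'_deriv assms by force
  then show ?thesis
    using R''_bounds[of z] assms by (auto simp: mult.commute intro!: mult_left_mono)
qed simp

lemma R'_mono: "1 \<le> x \<Longrightarrow> x \<le> y \<Longrightarrow> y \<le> v \<Longrightarrow> R' x \<le> R' y"
  using R'_increment[of x y] pos by (smt (verit) mult_nonneg_nonneg)

lemma R'_pos: "1 \<le> y \<Longrightarrow> y \<le> v \<Longrightarrow> R' y > 0"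
  using R'_mono[of 1 y] pos by linarith

lemma R_increment:
  assumes "1 \<le> x" "x \<le> y" "y \<le> v"
  shows "R' x * (y - x) \<le> R y - R x \<and> R y - R x \<le> R' y * (y - x)"
proof (cases "x = y")
  case False
  then obtain z where z: "x < z" "z < y" "R y - R x = (y - x) * R' z"
    using MVT2[of x y R R'] R_deriv assms by force
  then show ?thesis
    using R'_mono[of x z] R'_mono[of z y] assms by (auto simp: mult.commute intro!: mult_left_mono)
qed simp

lemma R_mono: "1 \<le> x \<Longrightarrow> x \<le> y \<Longrightarrow> y \<le> v \<Longrightarrow> R x \<le> R y"
  using R_increment[of x y] R'_pos[of x] by (smt (verit) mult_nonneg_nonneg)

text \<open>Remainder of the first-order Taylor expansion of \<open>R\<close> at
  \<open>v\<close>.\<close>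

definition tangent_gap :: "real \<Rightarrow> real" where
  "tangent_gap y = R y - R v + R' v * (v - y)"

text \<open>Subtracting \<open>m / 2 * (v - y)\<^sup>2\<close> leaves a function that vanishes at
  \<open>v\<close> and is monotone on the interval: nonincreasing for \<open>m = \<mu>\<close>,
  nondecreasing for \<open>m = M\<close>.\<close>

lemma tangent_gap_bounds:
  assumes "1 \<le> y" "y \<le> v"
  shows "\<mu> / 2 * (v - y)\<^sup>2 \<le> tangent_gap y \<and> tangent_gap y \<le> M / 2 * (v - y)\<^sup>2"
proof -
  have deriv: "((\<lambda>y. tangent_gap y - m / 2 * (v - y)\<^sup>2) has_real_derivative
      R' x - R' v + m * (v - x)) (at x)" if "x \<ge> 1" for x m
    unfolding tangent_gap_def using that
    by (auto intro!: derivative_eq_intros R_deriv simp: field_simps)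
  have at_v: "tangent_gap v = 0" by (simp add: tangent_gap_def)
  have "tangent_gap v - \<mu> / 2 * (v - v)\<^sup>2 \<le> tangent_gap y - \<mu> / 2 * (v - y)\<^sup>2"
  proof (rule DERIV_nonpos_imp_nonincreasing[OF assms(2)])
    fix x assume "y \<le> x" "x \<le> v"
    then show "\<exists>D. ((\<lambda>y. tangent_gap y - \<mu> / 2 * (v - y)\<^sup>2) has_real_derivative D) (at x) \<and> D \<le> 0"
      using deriv[of x \<mu>] R'_increment[of x v] assms by (intro exI conjI) auto
  qed
  moreover have "tangent_gap y - M / 2 * (v - y)\<^sup>2 \<le> tangent_gap v - M / 2 * (v - v)\<^sup>2"
  proof (rule DERIV_nonneg_imp_nondecreasing[OF assms(2)])
    fix x assume "y \<le> x" "x \<le> v"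
    then show "\<exists>D. ((\<lambda>y. tangent_gap y - M / 2 * (v - y)\<^sup>2) has_real_derivative D) (at x) \<and> 0 \<le> D"
      using deriv[of x M] R'_increment[of x v] assms by (intro exI conjI) auto
  qed
  ultimately show ?thesis by (simp add: at_v)
qed

text \<open>As \<open>R\<close> is monotone, the recursion preserves this box: \<open>total\<close>
  controls the lower corner and \<open>fixed\<close> the upper one. Strictness in
  \<open>w k < v\<close> keeps the distance to the fixed point positive.\<close>

lemma state_bounds: "1 \<le> u k \<and> u k \<le> u\<^sub>c \<and> 1 \<le> w k \<and> w k < v"
proof (induction k)
  case 0
  then show ?case using v u\<^sub>c init by simp
next
  case (Suc k)
  have "R 1 \<le> R (w k)" using Suc by (intro R_mono) auto
  moreover have "R (w k) < R v"
    using R_increment[of "w k" v] R'_pos[of "w k"] Suc by (smt (verit) mult_pos_pos)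
  moreover have "p\<^sub>1 \<le> p\<^sub>1 * u k" "p\<^sub>1 * u k \<le> p\<^sub>1 * u\<^sub>c"
    using Suc p\<^sub>1 by (auto simp: mult_left_mono mult_le_cancel_left1)
  moreover have "R (w k) \<le> b * R (w k)" "b * R (w k) < b * R v"
    using b pos calculation by (auto simp: mult_le_cancel_right1)
  ultimately show ?case using total fixed unfolding u_Suc w_Suc by linarith
qed

text \<open>\<open>(p\<^sub>1, 1 - p\<^sub>1)\<close> is the left eigenvector for the eigenvalue \<open>1\<close> of the linearised recursion
  at the fixed point, so that only the second-order term survives in the increment of \<open>S\<close>.\<close>

definition S :: "nat \<Rightarrow> real" where
  "S k = p\<^sub>1 * (u\<^sub>c - u k) + (1 - p\<^sub>1) * (v - w k)"

lemma gap_Suc: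
  "u\<^sub>c - u (Suc k) = p\<^sub>1 * (u\<^sub>c - u k) + (R v - R (w k))"
  "v - w (Suc k) = p\<^sub>1 * (u\<^sub>c - u k) + b * (R v - R (w k))"
  unfolding u_Suc w_Suc using fixed by (auto simp: algebra_simps)

text \<open>A weighted mean of \<open>x\<close> and \<open>y\<close> lies between
  \<open>y / b\<close> and \<open>y\<close>, so up to the factor \<open>b\<close> it can stand for
  the second component alone.\<close>

lemma weighted_bounds:
  assumes "0 \<le> x" "x \<le> y" "y \<le> b * x"
  shows "p\<^sub>1 * x + (1 - p\<^sub>1) * y \<le> y" "y \<le> b * (p\<^sub>1 * x + (1 - p\<^sub>1) * y)"
proof -
  have "p\<^sub>1 * x \<le> p\<^sub>1 * y" "p\<^sub>1 * y \<le> p\<^sub>1 * (b * x)" "(1 - p\<^sub>1) * y \<le> (1 - p\<^sub>1) * (b * y)"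
    using assms p\<^sub>1 b by (auto intro!: mult_left_mono simp: mult_le_cancel_right1)
  then show "p\<^sub>1 * x + (1 - p\<^sub>1) * y \<le> y" "y \<le> b * (p\<^sub>1 * x + (1 - p\<^sub>1) * y)"
    by (auto simp: algebra_simps)
qed

text \<open>One step of the recursion makes the two components comparable. This serves gaps,
  increments and derivatives alike.\<close>

lemma recursion_pair_bounds:
  assumes "x \<ge> 0" "r \<ge> 0"
  shows "p\<^sub>1 * x + r \<le> p\<^sub>1 * x + b * r" "p\<^sub>1 * x + b * r \<le> b * (p\<^sub>1 * x + r)"
proof -
  have "p\<^sub>1 * x \<le> b * (p\<^sub>1 * x)" "r \<le> b * r"
    using assms b p\<^sub>1 by (auto intro!: mult_right_mono[of 1 b, simplified])
  then show "p\<^sub>1 * x + r \<le> p\<^sub>1 * x + b * r" "p\<^sub>1 * x + b * r \<le> b * (p\<^sub>1 * x + r)"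
    by (auto simp: distrib_left)
qed

text \<open>Comparability of the two gaps comes from one step of the recursion, hence
  \<open>k \<ge> 1\<close>.\<close>

lemma S_bounds:
  assumes "k \<ge> 1"
  shows "S k \<le> v - w k" "v - w k \<le> b * S k"
proof -
  obtain j where k: "k = Suc j" using assms by (cases k) auto
  have r: "R v - R (w j) \<ge> 0" and x: "u\<^sub>c - u j \<ge> 0"
    using state_bounds[of j] R_mono[of "w j" v] by auto
  have "u\<^sub>c - u k \<ge> 0" using state_bounds[of k] by simp
  then show "S k \<le> v - w k" "v - w k \<le> b * S k"
    unfolding S_def using recursion_pair_bounds[OF x r]
    by (auto intro!: weighted_bounds simp: k gap_Suc)
qed

lemma S_pos: "S k > 0"
  unfolding S_def using state_bounds[of k] p\<^sub>1
  by (intro add_nonneg_pos) auto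

text \<open>By \<open>critical\<close>, the linear part of \<open>R v - R (w k)\<close> contributes
  exactly \<open>(1 - p\<^sub>1) * (v - w k)\<close> to \<open>S (Suc k)\<close>, which leaves the
  Taylor remainder.\<close>

lemma S_Suc: "S k - S (Suc k) = ((1 - p\<^sub>1) * b + p\<^sub>1) * tangent_gap (w k)"
proof -
  define K where "K = (1 - p\<^sub>1) * b + p\<^sub>1"
  have "S (Suc k) = p\<^sub>1 * (u\<^sub>c - u k) + K * (R v - R (w k))"
    unfolding S_def gap_Suc K_def by (simp add: algebra_simps)
  also have "R v - R (w k) = R' v * (v - w k) - tangent_gap (w k)"
    by (simp add: tangent_gap_def)
  also have "K * \<dots> = (1 - p\<^sub>1) * (v - w k) - K * tangent_gap (w k)"
    using critical by (simp add: K_def right_diff_distrib flip: mult.assoc)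
  finally show ?thesis by (simp add: S_def K_def)
qed

lemma S_decrement_bounds:
  obtains c C where "c > 0" "\<And>k. k \<ge> 1 \<Longrightarrow> c * (S k)\<^sup>2 \<le> S k - S (Suc k)"
    "\<And>k. k \<ge> 1 \<Longrightarrow> S k - S (Suc k) \<le> C * (S k)\<^sup>2"
proof -
  define K where "K = (1 - p\<^sub>1) * b + p\<^sub>1"
  have K: "K > 0" unfolding K_def using p\<^sub>1 b by (intro add_pos_nonneg) auto
  have M: "M > 0" using R''_bounds[of 1] v pos by linarith
  show thesis
  proof (rule that[of "K * (\<mu> / 2)" "K * (M / 2 * b\<^sup>2)"])
    fix k :: nat assume k: "k \<ge> 1"
    have gap: "\<mu> / 2 * (v - w k)\<^sup>2 \<le> tangent_gap (w k)" "tangent_gap (w k) \<le> M / 2 * (v - w k)\<^sup>2"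
      using tangent_gap_bounds[of "w k"] state_bounds[of k] by auto
    \<comment> \<open>Passing from the gap of \<open>w\<close> to \<open>S\<close> costs a factor
      \<open>b\<^sup>2\<close> in the upper bound.\<close>
    have "(S k)\<^sup>2 \<le> (v - w k)\<^sup>2" "(v - w k)\<^sup>2 \<le> (b * S k)\<^sup>2"
      using S_bounds[OF k] S_pos[of k] by (auto intro!: power_mono)
    then have "\<mu> / 2 * (S k)\<^sup>2 \<le> \<mu> / 2 * (v - w k)\<^sup>2" "M / 2 * (v - w k)\<^sup>2 \<le> M / 2 * (b * S k)\<^sup>2"
      using pos M by (auto intro!: mult_left_mono)
    then have "K * (\<mu> / 2 * (S k)\<^sup>2) \<le> K * tangent_gap (w k)"
        "K * tangent_gap (w k) \<le> K * (M / 2 * (b * S k)\<^sup>2)"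
      using gap K by (auto intro!: mult_left_mono)
    then show "K * (\<mu> / 2) * (S k)\<^sup>2 \<le> S k - S (Suc k)" "S k - S (Suc k) \<le> K * (M / 2 * b\<^sup>2) * (S k)\<^sup>2"
      unfolding S_Suc K_def[symmetric] by (auto simp: power_mult_distrib mult.assoc)
  qed (use K pos in simp)
qed

text \<open>The slope of \<open>R\<close> between \<open>w k\<close> and \<open>v\<close> is at
  least \<open>R' 1\<close>; the factor \<open>b\<close> gained in the recursion for
  \<open>w\<close> cancels the one lost in \<open>S_bounds\<close>. This supplies
  \<open>ratio\<close> in \<open>inverse_rate\<close>.\<close>

lemma S_ratio:
  assumes "k \<ge> 1"
  shows "R' 1 * S k \<le> S (Suc k)"
proof -
  have "R' 1 * S k \<le> R' (w k) * (v - w k)"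
    using state_bounds[of k] S_bounds[OF assms] S_pos[of k] R'_mono[of 1 "w k"] R'_pos[of "w k"]
    by (intro mult_mono) auto
  also have "\<dots> \<le> R v - R (w k)" using R_increment[of "w k" v] state_bounds[of k] by simp
  finally have r: "R' 1 * S k \<le> R v - R (w k)" .
  have "b * (R' 1 * S k) \<le> b * (R v - R (w k))" using r b by (intro mult_left_mono) auto
  also have "\<dots> \<le> v - w (Suc k)" unfolding gap_Suc using p\<^sub>1 state_bounds[of k] by simp
  also have "\<dots> \<le> b * S (Suc k)" by (rule S_bounds) simp
  finally show ?thesis using b by simp
qed

lemma S_rate:
  obtains A B where "A > 0" "\<And>k. k \<ge> 1 \<Longrightarrow> A \<le> real k * S k" "\<And>k. k \<ge> 1 \<Longrightarrow> real k * S k \<le> B"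
proof -
  obtain c C where "c > 0" "\<And>k. k \<ge> 1 \<Longrightarrow> c * (S k)\<^sup>2 \<le> S k - S (Suc k)"
      "\<And>k. k \<ge> 1 \<Longrightarrow> S k - S (Suc k) \<le> C * (S k)\<^sup>2"
    using S_decrement_bounds by blast
  then show thesis
    using inverse_rate[of S c C "R' 1"] S_pos S_ratio pos that by blast
qed

section \<open>Comparison of increments with derivatives\<close>

definition du :: "nat \<Rightarrow> real" where "du k = u (Suc k) - u k"
definition dw :: "nat \<Rightarrow> real" where "dw k = w (Suc k) - w k"

lemma increment_Suc:
  "du (Suc k) = p\<^sub>1 * du k + (R (w (Suc k)) - R (w k))"
  "dw (Suc k) = p\<^sub>1 * du k + b * (R (w (Suc k)) - R (w k))"
  by (auto simp: du_def dw_def u_Suc w_Suc algebra_simps)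

lemma increment_nonneg: "du k \<ge> 0 \<and> dw k \<ge> 0"
proof (induction k)
  case 0
  then show ?case
    using state_bounds[of 1] init by (simp add: du_def dw_def)
next
  case (Suc k)
  then have "R (w k) \<le> R (w (Suc k))"
    using state_bounds[of k] state_bounds[of "Suc k"] by (intro R_mono) (auto simp: dw_def)
  with Suc p\<^sub>1 b show ?case unfolding increment_Suc by simp
qed

text \<open>By convexity the chord slope lies between the end slopes. The left one is the
  coefficient in the recursion for \<open>a\<close> and \<open>d\<close> at the same index, the
  right one that at the next index.\<close>

lemma R_increment_w:
  "R' (w k) * dw k \<le> R (w (Suc k)) - R (w k) \<and> R (w (Suc k)) - R (w k) \<le> R' (w (Suc k)) * dw k"
  using R_increment[of "w k" "w (Suc k)"] state_bounds[of k] state_bounds[of "Suc k"]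
    increment_nonneg[of k] by (auto simp: dw_def)

lemma increment_ratio: "k \<ge> 1 \<Longrightarrow> du k \<le> dw k \<and> dw k \<le> b * du k"
proof -
  assume "k \<ge> 1"
  then obtain j where k: "k = Suc j" by (cases k) auto
  have "R (w (Suc j)) - R (w j) \<ge> 0"
    using state_bounds[of j] state_bounds[of "Suc j"] increment_nonneg[of j]
      R_mono[of "w j" "w (Suc j)"] by (simp add: dw_def)
  then show ?thesis
    unfolding k increment_Suc using recursion_pair_bounds increment_nonneg[of j] by blast
qed

lemma S_decrement_eq: "S k - S (Suc k) = p\<^sub>1 * du k + (1 - p\<^sub>1) * dw k"
  by (simp add: S_def du_def dw_def algebra_simps)

lemma S_decrement_increment:
  assumes "k \<ge> 1"
  shows "S k - S (Suc k) \<le> dw k" "dw k \<le> b * (S k - S (Suc k))"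
  unfolding S_decrement_eq
  using increment_ratio[OF assms] increment_nonneg[of k] by (auto intro!: weighted_bounds)

lemma deriv_pos: "a k > 0 \<and> d k > 0"
proof (induction k)
  case 0
  then show ?case by (simp add: init)
next
  case (Suc k)
  then show ?case
    unfolding a_Suc d_Suc using R'_pos[of "w k"] state_bounds[of k] p\<^sub>1 b
    by (intro conjI add_nonneg_pos mult_pos_pos mult_nonneg_nonneg) auto
qed

lemma deriv_ratio: "a k \<le> d k \<and> d k \<le> b * a k"
proof (cases k)
  case 0
  then show ?thesis using b by (simp add: init)
next
  case (Suc j)
  have "R' (w j) * d j \<ge> 0"
    using R'_pos[of "w j"] state_bounds[of j] deriv_pos[of j] by simp
  from recursion_pair_bounds[OF _ this, of "a j"] deriv_pos[of j] show ?thesis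
    unfolding Suc a_Suc d_Suc by (simp add: mult.assoc)
qed

text \<open>By \<open>total\<close>, \<open>du 0 = 0\<close>; positivity begins at index 1, where
  the first increment of \<open>w\<close>, due to \<open>b > 1\<close>, has reached both
  components.\<close>

lemma increment_1_pos: "du 1 > 0" "dw 1 > 0"
proof -
  have "dw 0 = (b - 1) * R 1"
    using total by (simp add: dw_def w_Suc init algebra_simps)
  then have "R' (w 0) * dw 0 > 0"
    using b pos init by simp
  then have r: "R (w (Suc 0)) - R (w 0) > 0" using R_increment_w[of 0] by linarith
  show "du 1 > 0"
    using increment_Suc(1)[of 0] r increment_nonneg[of 0] p\<^sub>1
    by (simp add: add_nonneg_pos)
  then show "dw 1 > 0" using increment_ratio[of 1] by simp
qed

text \<open>The left slope in \<open>R_increment_w\<close> makes the increments a supersolution of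
  the linearised recursion, so an initial comparison persists in both components.\<close>

lemma deriv_le_increment:
  obtains c where "c > 0" "\<And>k. k \<ge> 1 \<Longrightarrow> c * d k \<le> dw k"
proof -
  define c where "c = min (du 1 / a 1) (dw 1 / d 1)"
  have c: "c > 0" using increment_1_pos deriv_pos[of 1] by (simp add: c_def)
  have "c * a k \<le> du k \<and> c * d k \<le> dw k" if "k \<ge> 1" for k
    using that
  proof (induction k rule: dec_induct)
    case base
    then show ?case
      using deriv_pos[of 1] by (auto simp: c_def simp flip: pos_le_divide_eq)
  next
    case (step k)
    have R': "R' (w k) > 0" using R'_pos[of "w k"] state_bounds[of k] by simp
    have 1: "p\<^sub>1 * (c * a k) \<le> p\<^sub>1 * du k" using step p\<^sub>1 by (intro mult_left_mono) auto
    have "R' (w k) * (c * d k) \<le> R' (w k) * dw k" using step R' by (intro mult_left_mono) auto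
    also have "\<dots> \<le> R (w (Suc k)) - R (w k)" using R_increment_w by blast
    finally have 2: "R' (w k) * (c * d k) \<le> R (w (Suc k)) - R (w k)" .
    then have "b * (R' (w k) * (c * d k)) \<le> b * (R (w (Suc k)) - R (w k))"
      using b by (intro mult_left_mono) auto
    with 1 2 show ?case
      unfolding a_Suc d_Suc increment_Suc by (simp add: algebra_simps)
  qed
  with c show thesis using that by blast
qed

text \<open>\<open>R\<close> convex means that the linearisation at the right end point overestimates an increment,
  hence the shift of the index of \<open>d\<close>.\<close>

lemma increment_le_deriv:
  obtains C where "C > 0" "\<And>k. k \<ge> 1 \<Longrightarrow> dw k \<le> C * d (Suc k)"
proof -
  \<comment> \<open>Chosen so that the comparison holds at \<open>k = 1\<close>, against index 2 of
    \<open>a\<close> and \<open>d\<close>.\<close>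
  define C where "C = max (du 1 / a 2) (dw 1 / d 2)"
  have C: "C > 0" using increment_1_pos deriv_pos[of 2] by (simp add: C_def less_max_iff_disj)
  have "du k \<le> C * a (Suc k) \<and> dw k \<le> C * d (Suc k)" if "k \<ge> 1" for k
    using that
  proof (induction k rule: dec_induct)
    case base
    then show ?case
      using deriv_pos[of 2] by (auto simp: C_def numeral_2_eq_2 simp flip: pos_divide_le_eq)
  next
    case (step k)
    have R': "R' (w (Suc k)) > 0" using R'_pos[of "w (Suc k)"] state_bounds[of "Suc k"] by simp
    have 1: "p\<^sub>1 * du k \<le> p\<^sub>1 * (C * a (Suc k))" using step p\<^sub>1 by (intro mult_left_mono) auto
    have "R (w (Suc k)) - R (w k) \<le> R' (w (Suc k)) * dw k" using R_increment_w by blast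
    also have "\<dots> \<le> R' (w (Suc k)) * (C * d (Suc k))" using step R' by (intro mult_left_mono) auto
    finally have 2: "R (w (Suc k)) - R (w k) \<le> R' (w (Suc k)) * (C * d (Suc k))" .
    then have "b * (R (w (Suc k)) - R (w k)) \<le> b * (R' (w (Suc k)) * (C * d (Suc k)))"
      using b by (intro mult_left_mono) auto
    with 1 2 show ?case
      unfolding a_Suc[of "Suc k"] d_Suc[of "Suc k"] increment_Suc by (simp add: algebra_simps)
  qed
  with C show thesis using that by blast
qed

text \<open>The derivative is compared with \<open>dw\<close>, then with the decrement of
  \<open>S\<close>, with the square of \<open>S\<close>, and finally with
  \<open>1 / n\<^sup>2\<close>. Since \<open>a k \<le> d k\<close>, bounding \<open>a\<close> below
  and \<open>d\<close> above covers both.\<close>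

lemma deriv_rate:
  obtains A B where "A > 0" "\<And>n. n \<ge> 1 \<Longrightarrow> A \<le> (real n)\<^sup>2 * a (Suc n)"
    "\<And>n. n \<ge> 1 \<Longrightarrow> (real n)\<^sup>2 * d (Suc n) \<le> B"
proof -
  obtain c C where c: "c > 0" "\<And>k. k \<ge> 1 \<Longrightarrow> c * (S k)\<^sup>2 \<le> S k - S (Suc k)"
      and C: "\<And>k. k \<ge> 1 \<Longrightarrow> S k - S (Suc k) \<le> C * (S k)\<^sup>2"
    using S_decrement_bounds by blast
  obtain A B where A: "A > 0" "\<And>k. k \<ge> 1 \<Longrightarrow> A \<le> real k * S k"
      and B: "\<And>k. k \<ge> 1 \<Longrightarrow> real k * S k \<le> B"
    using S_rate by blast
  obtain c' where c': "c' > 0" "\<And>k. k \<ge> 1 \<Longrightarrow> c' * d k \<le> dw k" using deriv_le_increment by blast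
  obtain C' where C': "C' > 0" "\<And>k. k \<ge> 1 \<Longrightarrow> dw k \<le> C' * d (Suc k)" using increment_le_deriv by blast
  have C_pos: "C > 0"
    using c(2)[of 1] C[of 1] c(1) S_pos[of 1]
    by (smt (verit) mult_le_cancel_right_pos zero_less_power le_refl)
  show thesis
  proof (rule that[of "c * A\<^sup>2 / (C' * b)" "b * (C * B\<^sup>2) / c'"])
    show "c * A\<^sup>2 / (C' * b) > 0" using c A C' b by simp
  next
    fix n :: nat assume n: "n \<ge> 1"
    have "A\<^sup>2 \<le> (real n * S n)\<^sup>2" using A n by (intro power_mono) auto
    then have "c * A\<^sup>2 \<le> (real n)\<^sup>2 * (c * (S n)\<^sup>2)"
      using c(1) by (simp add: power_mult_distrib mult.left_commute)
    also have "\<dots> \<le> (real n)\<^sup>2 * (C' * (b * a (Suc n)))"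
    proof (rule mult_left_mono)
      have "c * (S n)\<^sup>2 \<le> C' * d (Suc n)"
        using c(2)[OF n] S_decrement_increment(1)[OF n] C'(2)[OF n] by linarith
      also have "\<dots> \<le> C' * (b * a (Suc n))"
        using C' deriv_ratio[of "Suc n"] by (intro mult_left_mono) auto
      finally show "c * (S n)\<^sup>2 \<le> C' * (b * a (Suc n))" .
    qed simp
    finally show "c * A\<^sup>2 / (C' * b) \<le> (real n)\<^sup>2 * a (Suc n)"
      using C' b by (simp add: pos_divide_le_eq mult_ac)
    have "c' * ((real n)\<^sup>2 * d (Suc n)) = (real n)\<^sup>2 * (c' * d (Suc n))" by simp
    \<comment> \<open>Enlarging \<open>n\<close> to \<open>n + 1\<close> matches the index of
      \<open>S\<close>.\<close>
    also have "\<dots> \<le> (real (Suc n))\<^sup>2 * (b * (C * (S (Suc n))\<^sup>2))"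
    proof (rule mult_mono)
      have "c' * d (Suc n) \<le> b * (S (Suc n) - S (Suc (Suc n)))"
        using c'(2)[of "Suc n"] S_decrement_increment(2)[of "Suc n"] by simp
      also have "\<dots> \<le> b * (C * (S (Suc n))\<^sup>2)"
        using C[of "Suc n"] b by (intro mult_left_mono) auto
      finally show "c' * d (Suc n) \<le> b * (C * (S (Suc n))\<^sup>2)" .
    qed (use c' deriv_pos[of "Suc n"] in \<open>auto intro!: power_mono\<close>)
    also have "\<dots> = b * (C * (real (Suc n) * S (Suc n))\<^sup>2)"
      by (simp add: power_mult_distrib mult_ac)
    also have "\<dots> \<le> b * (C * B\<^sup>2)"
      using B[of "Suc n"] S_pos[of "Suc n"] b C_pos
      by (intro mult_left_mono power_mono) auto
    finally show "(real n)\<^sup>2 * d (Suc n) \<le> b * (C * B\<^sup>2) / c'"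
      using c' by (simp add: pos_le_divide_eq mult_ac)
  qed
qed

end

subsection \<open>The critical parameter and the partition functions\<close>

locale subcritical_law =
  fixes p :: "nat pmf"
  assumes p0_pos: "pmf p 0 > 0"
    and branching: "pmf p 0 + pmf p 1 < 1"
    and mean_summable: "summable (\<lambda>k. real k * pmf p k)"
    and mean_less_1: "(\<Sum>k. real k * pmf p k) < 1"
    and entire: "\<And>v::real. v \<ge> 0 \<Longrightarrow> summable (\<lambda>k. pmf p (k + 2) * v ^ (k + 2))"
begin

text \<open>Coefficients of \<open>R\<close> in unshifted indexing, so that \<open>diffs\<close>
  yields those of its derivatives.\<close>

definition r :: "nat \<Rightarrow> real" where "r n = (if n < 2 then 0 else pmf p n)"
definition R' :: "real \<Rightarrow> real" where "R' y = (\<Sum>n. diffs r n * y ^ n)"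
definition R'' :: "real \<Rightarrow> real" where "R'' y = (\<Sum>n. diffs (diffs r) n * y ^ n)"
abbreviation "p\<^sub>0 \<equiv> pmf p 0"
abbreviation "p\<^sub>1 \<equiv> pmf p 1"

lemma r_nonneg: "r n \<ge> 0" "diffs r n \<ge> 0" "diffs (diffs r) n \<ge> 0"
  by (auto simp: r_def diffs_def)

lemma r_summable: "summable (\<lambda>n. r n * y ^ n)"
proof -
  have "summable (\<lambda>n. r (n + 2) * \<bar>y\<bar> ^ (n + 2))"
    using entire[of "\<bar>y\<bar>"] by (simp add: r_def)
  then have "summable (\<lambda>n. r n * \<bar>y\<bar> ^ n)"
    by (subst (asm) summable_iff_shift)
  then have "summable (\<lambda>n. \<bar>r n * y ^ n\<bar>)"
    using r_nonneg by (simp add: abs_mult power_abs)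
  then show ?thesis by (rule summable_rabs_cancel)
qed

lemma diffs_r_summable: "summable (\<lambda>n. diffs r n * y ^ n)"
  using r_summable by (rule termdiff_converges_all)

lemma diffs_diffs_r_summable: "summable (\<lambda>n. diffs (diffs r) n * y ^ n)"
  using diffs_r_summable by (rule termdiff_converges_all)

lemma R_eq: "R p y = (\<Sum>n. r n * y ^ n)"
proof -
  have "(\<Sum>n. r n * y ^ n) = (\<Sum>n. r (n + 2) * y ^ (n + 2)) + (\<Sum>n<2. r n * y ^ n)"
    using suminf_split_initial_segment[OF r_summable] by blast
  moreover have "(\<Sum>n<2. r n * y ^ n) = 0" by (auto simp: r_def)
  ultimately show ?thesis by (simp add: R_def r_def)
qed

lemma R_deriv: "(R p has_real_derivative R' y) (at y)"
proof -
  have "R p = (\<lambda>y. \<Sum>n. r n * y ^ n)" by (rule ext) (rule R_eq)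
  then show ?thesis
    unfolding R'_def using termdiffs_strong_converges_everywhere[OF r_summable] by simp
qed

lemma R'_deriv: "(R' has_real_derivative R'' y) (at y)"
  unfolding R'_def[abs_def] R''_def
  using termdiffs_strong_converges_everywhere[OF diffs_r_summable] by simp

lemma pmf_sums: "pmf p sums 1"
  using sums_infsetsum_nat'[OF pmf_abs_summable[of p UNIV]] infsetsum_pmf_eq_1[of p UNIV]
  by simp

lemma R_1: "R p 1 = 1 - p\<^sub>0 - p\<^sub>1"
proof -
  have "(\<lambda>n. pmf p n - (if n = 0 then p\<^sub>0 else 0) - (if n = 1 then p\<^sub>1 else 0)) sums (1 - p\<^sub>0 - p\<^sub>1)"
    using pmf_sums sums_single[of 0 "\<lambda>_. p\<^sub>0"] sums_single[of 1 "\<lambda>_. p\<^sub>1"]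
    by (intro sums_diff) auto
  also have "(\<lambda>n. pmf p n - (if n = 0 then p\<^sub>0 else 0) - (if n = 1 then p\<^sub>1 else 0)) = r"
    by (rule ext) (auto simp: r_def less_2_cases_iff)
  finally show ?thesis by (simp add: R_eq sums_iff)
qed

text \<open>\<open>R' 1\<close> is the mean offspring number minus \<open>p\<^sub>1\<close>, and the
  mean is below 1.\<close>

lemma R'_1_less: "R' 1 < 1 - p\<^sub>1"
proof -
  have "(\<lambda>n. real n * r n * 1 ^ (n - Suc 0)) sums R' 1"
    using diffs_equiv[OF diffs_r_summable[of 1]] by (simp add: R'_def)
  moreover have "(\<lambda>n. real n * pmf p n - (if n = 1 then p\<^sub>1 else 0)) sums ((\<Sum>k. real k * pmf p k) - p\<^sub>1)"
    using summable_sums[OF mean_summable] sums_single[of 1 "\<lambda>_. p\<^sub>1"]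
    by (intro sums_diff) auto
  moreover have "(\<lambda>n. real n * pmf p n - (if n = 1 then p\<^sub>1 else 0)) = (\<lambda>n. real n * r n * 1 ^ (n - Suc 0))"
    by (rule ext) (auto simp: r_def less_2_cases_iff)
  ultimately have "R' 1 = (\<Sum>k. real k * pmf p k) - p\<^sub>1" using sums_unique2 by metis
  then show ?thesis using mean_less_1 by simp
qed

lemma branching_witness: obtains k where "k \<ge> 2" "pmf p k > 0"
proof -
  have "\<exists>k. r k \<noteq> 0"
  proof (rule ccontr)
    assume "\<not> (\<exists>k. r k \<noteq> 0)"
    then have "R p 1 = 0" by (simp add: R_eq)
    then show False using R_1 branching by simp
  qed
  then obtain k where "r k \<noteq> 0" by blast
  then show thesis using that[of k] by (auto simp: r_def pmf_pos split: if_splits)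
qed

lemma R'_1_pos: "R' 1 > 0"
proof -
  obtain k where k: "k \<ge> 2" "pmf p k > 0" using branching_witness .
  then have "diffs r (k - 1) * 1 ^ (k - 1) > 0" by (auto simp: diffs_def r_def)
  then show ?thesis
    unfolding R'_def using diffs_r_summable[of 1] r_nonneg by (intro suminf_pos2) auto
qed

lemma R''_1_pos: "R'' 1 > 0"
proof -
  obtain k where k: "k \<ge> 2" "pmf p k > 0" using branching_witness .
  then obtain j where "k = Suc (Suc j)" by (metis add_2_eq_Suc le_Suc_ex)
  then have "diffs (diffs r) j * 1 ^ j > 0" using k by (simp add: diffs_def r_def)
  then show ?thesis
    unfolding R''_def using diffs_diffs_r_summable[of 1] r_nonneg by (intro suminf_pos2) auto
qed

lemma R''_mono: "0 \<le> x \<Longrightarrow> x \<le> y \<Longrightarrow> R'' x \<le> R'' y"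
  unfolding R''_def using r_nonneg diffs_diffs_r_summable
  by (intro suminf_le mult_left_mono power_mono) auto

lemma R'_mono: "0 \<le> x \<Longrightarrow> x \<le> y \<Longrightarrow> R' x \<le> R' y"
  unfolding R'_def using r_nonneg diffs_r_summable
  by (intro suminf_le mult_left_mono power_mono) auto

lemma R'_pos: "y \<ge> 1 \<Longrightarrow> R' y > 0"
  using R'_mono[of 1 y] R'_1_pos by simp

lemma R_strict_mono: "1 \<le> x \<Longrightarrow> x < y \<Longrightarrow> R p x < R p y"
  by (rule DERIV_pos_imp_increasing) (use R_deriv R'_pos in force)+

section \<open>Existence and uniqueness of the critical pair\<close>

definition A :: real where "A = p\<^sub>0 / (1 - p\<^sub>1)"

lemma p1_less_1: "p\<^sub>1 < 1"
  using p0_pos branching by linarith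

lemma A_bounds: "0 < A" "A < 1"
  using p0_pos branching p1_less_1 by (auto simp: A_def field_simps)

lemma R_1_eq_A: "R p 1 = (1 - p\<^sub>1) * (1 - A)"
  using p1_less_1 by (simp add: R_1 A_def field_simps)

text \<open>With \<open>B = ((1 - p\<^sub>1) b + p\<^sub>1) / (1 - p\<^sub>1)\<close> the critical system reads \<open>v = A + B R v\<close>,
  \<open>1 = B R' v\<close>; eliminating \<open>B\<close> leaves \<open>tangency v = 0\<close>.\<close>

definition tangency :: "real \<Rightarrow> real" where
  "tangency y = (y - A) * R' y - R p y"

lemma tangency_deriv: "(tangency has_real_derivative (y - A) * R'' y) (at y)"
  unfolding tangency_def[abs_def]
  by (auto intro!: derivative_eq_intros R_deriv R'_deriv simp: algebra_simps)

lemma tangency_strict_mono: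
  assumes "1 \<le> x" "x < y"
  shows "tangency x < tangency y"
proof (rule DERIV_pos_imp_increasing[OF assms(2)])
  fix z assume "x \<le> z"
  with assms have "1 \<le> z" by simp
  then have "(z - A) * R'' z > 0"
    using A_bounds R''_1_pos R''_mono[of 1 z] by auto
  then show "\<exists>D. (tangency has_real_derivative D) (at z) \<and> 0 < D"
    using tangency_deriv by blast
qed

text \<open>The value is \<open>(1 - A) * (R' 1 - (1 - p\<^sub>1))\<close>; subcriticality fixes its
  sign.\<close>

lemma tangency_1: "tangency 1 < 0"
proof -
  have "(1 - A) * R' 1 < (1 - A) * (1 - p\<^sub>1)"
    using R'_1_less A_bounds by simp
  then show ?thesis by (simp add: tangency_def R_1_eq_A mult.commute)
qed

lemma tangency_root: "\<exists>v>1. tangency v = 0"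
proof -
  define m where "m = (1 - A) * R'' 1"
  have m: "m > 0" using A_bounds R''_1_pos by (simp add: m_def)
  \<comment> \<open>The derivative of \<open>tangency\<close> is at least \<open>m\<close> beyond 1,
    and \<open>V\<close> is where the line of slope \<open>m\<close> through the value at 1
    vanishes.\<close>
  define V where "V = 1 - tangency 1 / m"
  have V: "V > 1" using tangency_1 m by (simp add: V_def divide_neg_pos)
  then obtain z where z: "1 < z" "z < V" "tangency V - tangency 1 = (V - 1) * ((z - A) * R'' z)"
    using MVT2[of 1 V tangency "\<lambda>z. (z - A) * R'' z"] tangency_deriv by blast
  have "m \<le> (z - A) * R'' z"
    unfolding m_def using z A_bounds R''_1_pos R''_mono[of 1 z] by (intro mult_mono) auto
  then have "(V - 1) * m \<le> tangency V - tangency 1"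
    unfolding z(3) using V by (intro mult_left_mono) auto
  then have "tangency V \<ge> 0" using m by (simp add: V_def)
  moreover have "continuous_on {1..V} tangency"
    by (rule DERIV_continuous_on[OF has_field_derivative_at_within[OF tangency_deriv]])
  ultimately obtain v where "1 \<le> v" "v \<le> V" "tangency v = 0"
    using IVT'[of tangency 1 0 V] tangency_1 V by auto
  moreover from this have "v \<noteq> 1" using tangency_1 by auto
  ultimately show ?thesis by (metis order_le_neq_trans)
qed

definition v :: real where "v = (THE y. y \<ge> 1 \<and> tangency y = 0)"

lemma v_unique: "y \<ge> 1 \<Longrightarrow> tangency y = 0 \<Longrightarrow> y = v" and v_root: "v > 1" "tangency v = 0"
proof -
  obtain y where y: "y > 1" "tangency y = 0" using tangency_root by blast
  have uniq: "z = y" if "z \<ge> 1" "tangency z = 0" for z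
    using tangency_strict_mono[of y z] tangency_strict_mono[of z y] that y by (cases y z rule: linorder_cases) auto
  have "v = y" unfolding v_def by (rule the_equality) (use y uniq in auto)
  with y uniq show "y \<ge> 1 \<Longrightarrow> tangency y = 0 \<Longrightarrow> y = v" "v > 1" "tangency v = 0" for y by auto
qed

text \<open>Given the second equation, \<open>tangency y\<close> is \<open>R' y\<close> times the
  defect of the first. The system thus decouples into a root condition on \<open>y\<close> and a
  linear equation for \<open>b\<close>.\<close>

lemma critical_system_iff:
  assumes "y \<ge> 1"
  shows "critical_system p b y \<longleftrightarrow> y = v \<and> ((1 - p\<^sub>1) * b + p\<^sub>1) * R' v = 1 - p\<^sub>1"
proof -
  define B where "B = ((1 - p\<^sub>1) * b + p\<^sub>1) / (1 - p\<^sub>1)"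
  have "critical_system p b y \<longleftrightarrow> y = A + B * R p y \<and> 1 = B * R' y"
    by (simp add: critical_system_def A_def B_def DERIV_imp_deriv[OF R_deriv])
  also have "\<dots> \<longleftrightarrow> 1 = B * R' y \<and> tangency y = 0"
  proof -
    have "y = A + B * R p y \<longleftrightarrow> tangency y = 0" if B: "1 = B * R' y"
    proof -
      have "tangency y = R' y * (y - (A + B * R p y))"
        using arg_cong[OF B, of "\<lambda>t. t * R p y"] by (simp add: tangency_def algebra_simps)
      then show ?thesis using R'_pos[OF assms] by simp
    qed
    then show ?thesis by blast
  qed
  also have "\<dots> \<longleftrightarrow> y = v \<and> 1 = B * R' v"
    using v_unique[OF assms] v_root by blast
  also have "1 = B * R' v \<longleftrightarrow> ((1 - p\<^sub>1) * b + p\<^sub>1) * R' v = 1 - p\<^sub>1"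
    using p1_less_1 by (auto simp: B_def field_simps)
  finally show ?thesis .
qed

text \<open>At \<open>v\<close> the remaining equation is linear in \<open>b\<close> with positive
  slope \<open>(1 - p\<^sub>1) * R' v\<close>, so the description in \<open>critical_pair\<close>
  has exactly one solution.\<close>

lemma b_crit_critical: "((1 - p\<^sub>1) * b_crit p + p\<^sub>1) * R' v = 1 - p\<^sub>1"
proof -
  define b where "b = ((1 - p\<^sub>1) / R' v - p\<^sub>1) / (1 - p\<^sub>1)"
  have R': "R' v > 0" using v_root R'_pos by simp
  have crit: "((1 - p\<^sub>1) * b' + p\<^sub>1) * R' v = 1 - p\<^sub>1 \<longleftrightarrow> b' = b" for b'
    using p1_less_1 R' by (auto simp: b_def field_simps)
  have "critical_pair p = (b, v)"
    unfolding critical_pair_def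
  proof (rule the_equality)
    show "1 \<le> snd (b, v) \<and> critical_system p (fst (b, v)) (snd (b, v))"
      using v_root crit by (simp add: critical_system_iff)
    show "bv = (b, v)" if "1 \<le> snd bv \<and> critical_system p (fst bv) (snd bv)" for bv
      using that crit critical_system_iff by (metis prod.collapse)
  qed
  then show ?thesis using crit by (simp add: b_crit_def)
qed

text \<open>Strict convexity puts the chord slope of \<open>R\<close> on \<open>[1, v]\<close> below
  \<open>R' v\<close>; inserted in \<open>tangency v = 0\<close> this gives
  \<open>R' v < 1 - p\<^sub>1\<close>.\<close>

lemma b_crit_gt_1: "b_crit p > 1"
proof -
  obtain z where z: "1 < z" "z < v" "R p v - R p 1 = (v - 1) * R' z"
    using MVT2[of 1 v "R p" R'] R_deriv v_root by blast
  have "R' z < R' v"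
    by (rule DERIV_pos_imp_increasing[OF z(2)])
       (use z R'_deriv R''_1_pos R''_mono in \<open>meson less_le_trans order.strict_implies_order order_trans zero_le_one\<close>)
  then have "R p v - R p 1 < (v - 1) * R' v" using z v_root by simp
  then have "(1 - A) * R' v < (1 - A) * (1 - p\<^sub>1)"
    using v_root(2) by (simp add: tangency_def R_1_eq_A algebra_simps)
  then have "R' v < 1 - p\<^sub>1" using A_bounds by simp
  then have "1 * R' v < ((1 - p\<^sub>1) * b_crit p + p\<^sub>1) * R' v" using b_crit_critical by simp
  then have "1 < (1 - p\<^sub>1) * b_crit p + p\<^sub>1"
    using R'_pos[of v] v_root by (simp only: mult_less_cancel_right_pos)
  then have "(1 - p\<^sub>1) * 1 < (1 - p\<^sub>1) * b_crit p" by simp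
  then show ?thesis using p1_less_1 by (simp only: mult_less_cancel_left_pos diff_gt_0_iff_gt)
qed

section \<open>Partition functions and unnormalised expectations\<close>

definition Z :: "real \<Rightarrow> nat \<Rightarrow> nat \<Rightarrow> real" where
  "Z \<beta> x k = infsum (boltzmann p \<beta> k x) (trees_within k)"

definition D :: "real \<Rightarrow> nat \<Rightarrow> nat \<Rightarrow> real" where
  "D \<beta> x k = infsum (\<lambda>t. boltzmann p \<beta> k x t * real (level_size k t)) (trees_within k)"

text \<open>The interaction sees only whether \<open>x\<close> is at least 2, so the boundary
  conditions 1 and 2 represent all others.\<close>

lemma boltzmann_parent: "boltzmann p \<beta> k x = boltzmann p \<beta> k (if x \<ge> 2 then 2 else 1)"
  by (rule ext, cases k) (auto simp: interaction_def)

lemma Z_parent: "Z \<beta> x k = (if x \<ge> 2 then Z \<beta> 2 k else Z \<beta> 1 k)"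
  and D_parent: "D \<beta> x k = (if x \<ge> 2 then D \<beta> 2 k else D \<beta> 1 k)"
  unfolding Z_def D_def boltzmann_parent[of \<beta> k x] by auto

text \<open>The root has no child, one child with boundary condition 1, or at least two children
  with boundary condition 2; the factor \<open>exp \<beta>\<close> arises in the last case when also
  \<open>x \<ge> 2\<close>.\<close>

lemma has_sum_boltzmann_Suc:
  assumes summable: "\<And>x. boltzmann p \<beta> k x summable_on trees_within k"
    "\<And>x. (\<lambda>t. boltzmann p \<beta> k x t * real (level_size k t)) summable_on trees_within k"
  defines "e x \<equiv> if x \<ge> 2 then exp \<beta> else 1"
  shows "(boltzmann p \<beta> (Suc k) x has_sum p\<^sub>0 + p\<^sub>1 * Z \<beta> 1 k + e x * R p (Z \<beta> 2 k))
      (trees_within (Suc k))" (is ?thesis1)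
    and "((\<lambda>t. boltzmann p \<beta> (Suc k) x t * real (level_size (Suc k) t))
      has_sum p\<^sub>1 * D \<beta> 1 k + e x * R' (Z \<beta> 2 k) * D \<beta> 2 k) (trees_within (Suc k))" (is ?thesis2)
proof -
  define w where "w m = pmf p m * exp (- \<beta> * interaction x m)" for m
  have f: "(boltzmann p \<beta> k m has_sum Z \<beta> m k) (trees_within k)" for m
    unfolding Z_def by (rule has_sum_infsum[OF summable(1)])
  have g: "((\<lambda>t. boltzmann p \<beta> k m t * real (level_size k t)) has_sum D \<beta> m k) (trees_within k)" for m
    unfolding D_def by (rule has_sum_infsum[OF summable(2)])
  have "(\<lambda>m. (if m = 0 then p\<^sub>0 else 0) + (if m = 1 then p\<^sub>1 * Z \<beta> 1 k else 0) +
      e x * (r m * Z \<beta> 2 k ^ m)) sums (p\<^sub>0 + p\<^sub>1 * Z \<beta> 1 k + e x * R p (Z \<beta> 2 k))"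
    unfolding R_eq using sums_single[of 0 "\<lambda>_. p\<^sub>0"] sums_single[of 1 "\<lambda>_. p\<^sub>1 * Z \<beta> 1 k"]
    by (intro sums_add sums_mult summable_sums r_summable) auto
  also have "(\<lambda>m. (if m = 0 then p\<^sub>0 else 0) + (if m = 1 then p\<^sub>1 * Z \<beta> 1 k else 0) +
      e x * (r m * Z \<beta> 2 k ^ m)) = (\<lambda>m. w m * Z \<beta> m k ^ m)"
    by (rule ext, subst Z_parent)
       (auto simp: w_def e_def r_def interaction_def less_2_cases_iff)
  finally have S: "(\<lambda>m. w m * Z \<beta> m k ^ m) sums (p\<^sub>0 + p\<^sub>1 * Z \<beta> 1 k + e x * R p (Z \<beta> 2 k))" .
  have "(\<lambda>m. real m * r m * Z \<beta> 2 k ^ (m - Suc 0)) sums R' (Z \<beta> 2 k)"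
    unfolding R'_def using diffs_equiv[OF diffs_r_summable] by simp
  then have "(\<lambda>m. (if m = 1 then p\<^sub>1 * D \<beta> 1 k else 0) +
      e x * (real m * r m * Z \<beta> 2 k ^ (m - Suc 0)) * D \<beta> 2 k)
      sums (p\<^sub>1 * D \<beta> 1 k + e x * R' (Z \<beta> 2 k) * D \<beta> 2 k)"
    using sums_single[of 1 "\<lambda>_. p\<^sub>1 * D \<beta> 1 k"]
    by (intro sums_add sums_mult sums_mult2) auto
  also have "(\<lambda>m. (if m = 1 then p\<^sub>1 * D \<beta> 1 k else 0) +
      e x * (real m * r m * Z \<beta> 2 k ^ (m - Suc 0)) * D \<beta> 2 k) =
      (\<lambda>m. w m * (real m * Z \<beta> m k ^ (m - 1) * D \<beta> m k))"
    by (rule ext, subst Z_parent, subst D_parent)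
       (auto simp: w_def e_def r_def interaction_def less_2_cases_iff)
  finally have T: "(\<lambda>m. w m * (real m * Z \<beta> m k ^ (m - 1) * D \<beta> m k)) sums
      (p\<^sub>1 * D \<beta> 1 k + e x * R' (Z \<beta> 2 k) * D \<beta> 2 k)" .
  note sums = has_sum_trees_within_Suc[where f = "boltzmann p \<beta> k" and c = w, OF f g _ _ _ S T]
  have level: "real (level_size (Suc k) t) = sum_list (map (\<lambda>t. real (level_size k t)) (children t))" for t
    by (simp add: sum_list_map_nth)
  have w: "w m \<ge> 0" for m by (simp add: w_def)
  have Suc: "boltzmann p \<beta> (Suc k) x = (\<lambda>t. w (length (children t)) *
      prod_list (map (boltzmann p \<beta> k (length (children t))) (children t)))"
    by (rule ext) (simp add: w_def)
  show ?thesis1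
    unfolding Suc using sums(1) boltzmann_nonneg w by simp
  show ?thesis2
    unfolding Suc level using sums(2) boltzmann_nonneg w by simp
qed

text \<open>The induction treats all boundary conditions at once, since the children carry their
  own. The new sums converge because the power series of \<open>R\<close> and \<open>R'\<close>
  converge everywhere.\<close>

lemma boltzmann_summable:
  "boltzmann p \<beta> k x summable_on trees_within k"
  "(\<lambda>t. boltzmann p \<beta> k x t * real (level_size k t)) summable_on trees_within k"
proof -
  have "(\<forall>x. boltzmann p \<beta> k x summable_on trees_within k) \<and>
      (\<forall>x. (\<lambda>t. boltzmann p \<beta> k x t * real (level_size k t)) summable_on trees_within k)"
  proof (induction k)
    case 0
    then show ?case by (simp add: trees_within_0)
  next
    case (Suc k)
    then show ?case
      using has_sum_boltzmann_Suc[of \<beta> k] has_sum_imp_summable by blast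
  qed
  then show "boltzmann p \<beta> k x summable_on trees_within k"
    "(\<lambda>t. boltzmann p \<beta> k x t * real (level_size k t)) summable_on trees_within k"
    by auto
qed

lemma Z_D_0: "Z \<beta> x 0 = 1" "D \<beta> x 0 = 1"
  by (auto simp: Z_def D_def trees_within_0)

lemma Z_Suc: "Z \<beta> x (Suc k) = p\<^sub>0 + p\<^sub>1 * Z \<beta> 1 k + (if x \<ge> 2 then exp \<beta> else 1) * R p (Z \<beta> 2 k)"
  unfolding Z_def[of \<beta> x "Suc k"]
  by (rule infsumI has_sum_boltzmann_Suc boltzmann_summable)+

lemma D_Suc:
  "D \<beta> x (Suc k) = p\<^sub>1 * D \<beta> 1 k + (if x \<ge> 2 then exp \<beta> else 1) * R' (Z \<beta> 2 k) * D \<beta> 2 k"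
  unfolding D_def[of \<beta> x "Suc k"]
  by (rule infsumI has_sum_boltzmann_Suc boltzmann_summable)+

lemma gibbs_expectation_num_external:
  "gibbs_expectation p \<beta> x n (\<lambda>t. real (num_external n t)) = D \<beta> x (Suc n) / Z \<beta> x (Suc n)"
proof -
  have "partition_function p \<beta> x n = Z \<beta> x (Suc n)"
    by (simp only: partition_function_def gw_weight_boltzmann Z_def trees_eq_trees_within)
  then have "gibbs_expectation p \<beta> x n (\<lambda>t. real (num_external n t)) =
      (\<Sum>\<^sub>\<infinity>t\<in>trees_within (Suc n).
        (boltzmann p \<beta> (Suc n) x t * real (level_size (Suc n) t)) * inverse (Z \<beta> x (Suc n)))"
    by (simp only: gibbs_expectation_def gibbs_prob_def gw_weight_boltzmann trees_eq_trees_within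
          num_external_level_size divide_inverse mult_ac)
  also have "\<dots> = D \<beta> x (Suc n) / Z \<beta> x (Suc n)"
    by (simp only: infsum_cmult_left' D_def divide_inverse)
  finally show ?thesis .
qed

text \<open>The value for \<open>u\<^sub>c\<close> solves the first fixed point equation, and
  monotonicity of \<open>R''\<close> supplies the curvature bounds \<open>R'' 1\<close> and
  \<open>R'' v\<close>.\<close>

lemma tangent_recursion_critical:
  assumes "exp \<beta> = b_crit p"
  shows "tangent_recursion (R p) R' R'' p\<^sub>0 p\<^sub>1 (b_crit p) v ((p\<^sub>0 + R p v) / (1 - p\<^sub>1)) (R'' 1) (R'' v)
    (Z \<beta> 1) (Z \<beta> 2) (D \<beta> 1) (D \<beta> 2)"
proof
  show "R'' 1 \<le> R'' y \<and> R'' y \<le> R'' v" if "1 \<le> y" "y \<le> v" for y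
    using that R''_mono by simp
  show "R p 1 > 0" using R_1 branching by simp
  have "R p 1 < R p v" using R_strict_mono v_root by simp
  then show "1 \<le> (p\<^sub>0 + R p v) / (1 - p\<^sub>1)"
    using p1_less_1 by (simp add: R_1 pos_le_divide_eq)
  show "(p\<^sub>0 + R p v) / (1 - p\<^sub>1) = p\<^sub>0 + p\<^sub>1 * ((p\<^sub>0 + R p v) / (1 - p\<^sub>1)) + R p v"
    using p1_less_1 by (simp add: field_simps)
  \<comment> \<open>The root condition \<open>(v - A) * R' v = R p v\<close> converts the critical
    slope equation into the second fixed point equation.\<close>
  have "(1 - p\<^sub>1) * (v - A) = ((1 - p\<^sub>1) * b_crit p + p\<^sub>1) * ((v - A) * R' v)"
    using b_crit_critical by simp
  also have "(v - A) * R' v = R p v" using v_root by (simp add: tangency_def)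
  finally have "(1 - p\<^sub>1) * v = (1 - p\<^sub>1) * A + ((1 - p\<^sub>1) * b_crit p + p\<^sub>1) * R p v"
    by (simp add: algebra_simps)
  also have "(1 - p\<^sub>1) * A = p\<^sub>0" using p1_less_1 by (simp add: A_def)
  finally have "v = (p\<^sub>0 + ((1 - p\<^sub>1) * b_crit p + p\<^sub>1) * R p v) / (1 - p\<^sub>1)"
    using p1_less_1 by (simp add: eq_divide_eq mult.commute)
  also have "\<dots> = p\<^sub>0 + p\<^sub>1 * ((p\<^sub>0 + R p v) / (1 - p\<^sub>1)) + b_crit p * R p v"
    using p1_less_1 by (simp add: divide_simps) (simp add: algebra_simps)
  finally show "v = p\<^sub>0 + p\<^sub>1 * ((p\<^sub>0 + R p v) / (1 - p\<^sub>1)) + b_crit p * R p v" .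
qed (use R_deriv R'_deriv R''_1_pos R'_1_pos p0_pos p1_less_1 b_crit_gt_1 v_root b_crit_critical
      R_1 assms in \<open>simp_all add: Z_D_0 Z_Suc D_Suc\<close>)

text \<open>The normalisation stays between 1 and \<open>u\<^sub>c + v\<close>, so only the order of
  \<open>D\<close> matters, and \<open>D \<beta> x\<close> lies between \<open>D \<beta> 1\<close>
  and \<open>D \<beta> 2\<close>.\<close>

lemma expectation_rate:
  assumes "exp \<beta> = b_crit p" "x \<in> {1, 2}"
  obtains l h where "l > 0"
    "\<And>n. n \<ge> 1 \<Longrightarrow> l \<le> (real n)\<^sup>2 * gibbs_expectation p \<beta> x n (\<lambda>t. real (num_external n t))"
    "\<And>n. n \<ge> 1 \<Longrightarrow> (real n)\<^sup>2 * gibbs_expectation p \<beta> x n (\<lambda>t. real (num_external n t)) \<le> h"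
proof -
  define u\<^sub>c where "u\<^sub>c = (p\<^sub>0 + R p v) / (1 - p\<^sub>1)"
  interpret tangent_recursion "R p" R' R'' p\<^sub>0 p\<^sub>1 "b_crit p" v u\<^sub>c "R'' 1" "R'' v"
      "Z \<beta> 1" "Z \<beta> 2" "D \<beta> 1" "D \<beta> 2"
    unfolding u\<^sub>c_def by (rule tangent_recursion_critical[OF assms(1)])
  obtain l h where l: "l > 0" "\<And>n. n \<ge> 1 \<Longrightarrow> l \<le> (real n)\<^sup>2 * D \<beta> 1 (Suc n)"
      and h: "\<And>n. n \<ge> 1 \<Longrightarrow> (real n)\<^sup>2 * D \<beta> 2 (Suc n) \<le> h"
    using deriv_rate by blast
  have Z: "1 \<le> Z \<beta> x k" "Z \<beta> x k \<le> u\<^sub>c + v" for k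
    using state_bounds[of k] assms(2) v u\<^sub>c by auto
  have D: "D \<beta> 1 k \<le> D \<beta> x k" "D \<beta> x k \<le> D \<beta> 2 k" "D \<beta> x k > 0" for k
    using deriv_ratio[of k] deriv_pos[of k] assms(2) by auto
  show thesis
  proof (rule that[of "l / (u\<^sub>c + v)" h])
    show "l / (u\<^sub>c + v) > 0" using l u\<^sub>c v by simp
  next
    fix n :: nat assume n: "n \<ge> 1"
    have "l \<le> (real n)\<^sup>2 * D \<beta> x (Suc n)"
      using l(2)[OF n] D(1)[of "Suc n"] by (meson mult_left_mono order_trans zero_le_power2)
    then have "l / (u\<^sub>c + v) \<le> (real n)\<^sup>2 * D \<beta> x (Suc n) / Z \<beta> x (Suc n)"
      using Z[of "Suc n"] l by (intro frac_le) auto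
    then show "l / (u\<^sub>c + v) \<le> (real n)\<^sup>2 * gibbs_expectation p \<beta> x n (\<lambda>t. real (num_external n t))"
      by (simp add: gibbs_expectation_num_external)
    have "(real n)\<^sup>2 * D \<beta> x (Suc n) / Z \<beta> x (Suc n) \<le> (real n)\<^sup>2 * D \<beta> x (Suc n) / 1"
      using Z[of "Suc n"] D[of "Suc n"] by (intro divide_left_mono) auto
    also have "\<dots> \<le> (real n)\<^sup>2 * D \<beta> 2 (Suc n)"
      using D[of "Suc n"] by (simp add: mult_left_mono)
    also have "\<dots> \<le> h" by (rule h[OF n])
    finally show "(real n)\<^sup>2 * gibbs_expectation p \<beta> x n (\<lambda>t. real (num_external n t)) \<le> h"
      by (simp add: gibbs_expectation_num_external)
  qed
qed

end

theorem corollary1: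
  fixes p :: "nat pmf" and x :: nat and \<beta> :: real
  assumes "pmf p 0 > 0"
    and "pmf p 0 + pmf p 1 < 1"
    and "summable (\<lambda>k. real k * pmf p k)" and "(\<Sum>k. real k * pmf p k) < 1"
    and "\<And>v::real. v \<ge> 0 \<Longrightarrow> summable (\<lambda>k. pmf p (k + 2) * v ^ (k + 2))"
    and "x \<in> {1, 2}"
    and "exp \<beta> = b_crit p"
  shows "\<exists>C::real. C > 1 \<and>
    (\<forall>n\<ge>1. inverse C < (real n)\<^sup>2 * gibbs_expectation p \<beta> x n (\<lambda>t. real (num_external n t)) \<and>
           (real n)\<^sup>2 * gibbs_expectation p \<beta> x n (\<lambda>t. real (num_external n t)) < C)"
proof -
  interpret subcritical_law p
    using assms(1-5) by unfold_locales
  let ?E = "\<lambda>n. (real n)\<^sup>2 * gibbs_expectation p \<beta> x n (\<lambda>t. real (num_external n t))"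
  obtain l h where l: "l > 0" "\<And>n. n \<ge> 1 \<Longrightarrow> l \<le> ?E n" and h: "\<And>n. n \<ge> 1 \<Longrightarrow> ?E n \<le> h"
    using expectation_rate[OF assms(7,6)] by blast
  \<comment> \<open>\<open>inverse l < C\<close> gives \<open>inverse C < l\<close>; the summand 1
    makes the inequalities strict.\<close>
  define C where "C = 1 + inverse l + \<bar>h\<bar>"
  have C: "C > 1" "inverse l < C" "h < C"
    using positive_imp_inverse_positive[OF l(1)] unfolding C_def by linarith+
  have "inverse C < l"
    using less_imp_inverse_less[OF C(2)] l(1) by simp
  then have "inverse C < ?E n \<and> ?E n < C" if "n \<ge> 1" for n
    using l(2)[OF that] h[OF that] C(3) by linarith
  with C(1) show ?thesis by blast
qed

end
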